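(* Let $\mathcal A$ be a hyperplane arrangement. For every $2$-flat $X\in L_2(\mathcal A)$ lying at the intersection of at least $3$ hyperplanes of $\mathcal A$, the corresponding local component $$P_X=\Bigl\{\sum_{H\in\mathcal A}a_He_H\in V^\vee:\ \sum_{H\supset X}a_H=0\ \text{and}\ a_H=0\text{ for }H\not\supset X\Bigr\}$$ of $\mathcal R(\mathcal A)$ is separable, that is, $(P_X\wedge V^\vee)\cap K^\perp\subseteq\bigwedge^2P_X$.
   Context: An arrangement $\mathcal A$ is a finite set of linear hyperplanes (through the origin) in $\mathbb C^\ell$. $L_2(\mathcal A)$ is the set of $2$-flats, i.e. codimension $2$ subspaces that are intersections of hyperplanes of $\mathcal A$. $V^\vee=H^1(M(\mathcal A),\mathbb C)$, where $M(\mathcal A)$ is the complement, is the vector space with basis $\{e_H\}_{H\in\mathcal A}$. $K^\perp=I^2(\mathcal A)\subseteq\bigwedge^2V^\vee$ is the kernel of the cup product $\bigwedge^2H^1(M(\mathcal A),\mathbb C)\to H^2(M(\mathcal A),\mathbb C)$; equivalently, the span of the elements $(e_H-e_{H''})\wedge(e_{H'}-e_{H''})$ for distinct $H,H',H''\in\mathcal A$ with $\mathrm{codim}(H\cap H'\cap H'')=2$. The resonance variety is $\mathcal R(\mathcal A)=\{a\in V^\vee:\exists\, b\in V^\vee,\ a\wedge b\in K^\perp\setminus\{0\}\}\cup\{0\}$; for each $2$-flat $X\in L_2(\mathcal A)$ contained in at least $3$ hyperplanes of $\mathcal A$, the linear subspace $P_X=\bigl\{\sum_{H\in\mathcal A}a_He_H\in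 V^\vee:\ \sum_{H\supset X}a_H=0\ \text{and}\ a_H=0\text{ for }H\not\supset X\bigr\}$ is an irreducible component of it. *)

theory Defs
  imports "HOL-Analysis.Analysis" "HOL-Library.Function_Algebras"
begin

subsection \<open>Arrangements and 2-flats\<close>

definition codim :: "(complex ^ 'l) set \<Rightarrow> nat" where
  "codim S = CARD('l) - vec.dim S"

definition hyperplane :: "(complex ^ 'l) set \<Rightarrow> bool" where
  "hyperplane H \<longleftrightarrow> vec.subspace H \<and> codim H = 1"

definition arrangement :: "(complex ^ 'l) set set \<Rightarrow> bool" where
  "arrangement A \<longleftrightarrow> finite A \<and> (\<forall>H\<in>A. hyperplane H)"

definition flats2 :: "(complex ^ 'l) set set \<Rightarrow> (complex ^ 'l) set set" where
  "flats2 A = {\<Inter>B |B. B \<subseteq> A \<and> codim (\<Inter>B) = 2}"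


subsection \<open>Functions as a complex vector space, and exterior squares\<close>

definition cscale :: "complex \<Rightarrow> ('i \<Rightarrow> complex) \<Rightarrow> 'i \<Rightarrow> complex" where
  "cscale c f = (\<lambda>i. c * f i)"

interpretation cfun: vector_space cscale
  by unfold_locales (auto simp: cscale_def fun_eq_iff algebra_simps)

text \<open>
  A vector \<open>\<Sum>\<^sub>H a\<^sub>H e\<^sub>H\<close> is represented by its coordinate function \<open>a\<close>; an element of the
  exterior square is represented by the antisymmetric array whose entry at \<open>(H, K)\<close> is the
  coefficient of \<open>e\<^sub>H \<and> e\<^sub>K\<close>. For \<open>H \<noteq> K\<close> the array \<open>wedge (basis_vec H) (basis_vec K)\<close> has entry
  \<open>1\<close> at \<open>(H, K)\<close>, \<open>-1\<close> at \<open>(K, H)\<close> and \<open>0\<close> elsewhere.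
\<close>

definition basis_vec :: "'h \<Rightarrow> 'h \<Rightarrow> complex" where
  "basis_vec H = (\<lambda>K. if K = H then 1 else 0)"

definition wedge :: "('h \<Rightarrow> complex) \<Rightarrow> ('h \<Rightarrow> complex) \<Rightarrow> 'h \<times> 'h \<Rightarrow> complex" where
  "wedge a b = (\<lambda>(H, K). a H * b K - a K * b H)"

definition wedge_space ::
  "('h \<Rightarrow> complex) set \<Rightarrow> ('h \<Rightarrow> complex) set \<Rightarrow> ('h \<times> 'h \<Rightarrow> complex) set" where
  "wedge_space P Q = cfun.span {wedge a b |a b. a \<in> P \<and> b \<in> Q}"

definition ext_square :: "('h \<Rightarrow> complex) set \<Rightarrow> ('h \<times> 'h \<Rightarrow> complex) set" where
  "ext_square P = wedge_space P P"


subsection \<open>Resonance and separability\<close>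

text \<open>The space \<open>V\<^sup>\<or> = H\<^sup>1(M(A), \<complex>)\<close>, with basis \<open>e\<^sub>H\<close> indexed by the hyperplanes \<open>H \<in> A\<close>.\<close>

definition H1 :: "(complex ^ 'l) set set \<Rightarrow> ((complex ^ 'l) set \<Rightarrow> complex) set" where
  "H1 A = {a. \<forall>H. H \<notin> A \<longrightarrow> a H = 0}"

text \<open>
  The space \<open>K\<^sup>\<bottom> = I\<^sup>2(A)\<close>, the degree 2 part of the Orlik-Solomon ideal, which is the kernel of
  the cup product on \<open>H\<^sup>1(M(A), \<complex>)\<close>, given by its standard generators.
\<close>

definition K_perp ::
  "(complex ^ 'l) set set \<Rightarrow> ((complex ^ 'l) set \<times> (complex ^ 'l) set \<Rightarrow> complex) set" where
  "K_perp A = cfun.span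
     {wedge (basis_vec H - basis_vec H'') (basis_vec H' - basis_vec H'') |H H' H''.
        H \<in> A \<and> H' \<in> A \<and> H'' \<in> A \<and> H \<noteq> H' \<and> H \<noteq> H'' \<and> H' \<noteq> H'' \<and>
        codim (H \<inter> H' \<inter> H'') = 2}"

definition resonance :: "(complex ^ 'l) set set \<Rightarrow> ((complex ^ 'l) set \<Rightarrow> complex) set" where
  "resonance A = {a \<in> H1 A. \<exists>b \<in> H1 A. wedge a b \<in> K_perp A - {0}} \<union> {0}"

definition local_component ::
  "(complex ^ 'l) set set \<Rightarrow> (complex ^ 'l) set \<Rightarrow> ((complex ^ 'l) set \<Rightarrow> complex) set" where
  "local_component A X =
     {a \<in> H1 A. (\<Sum>H | H \<in> A \<and> X \<subseteq> H. a H) = 0 \<and> (\<forall>H\<in>A. \<not> X \<subseteq> H \<longrightarrow> a H = 0)}"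

definition separable ::
  "(complex ^ 'l) set set \<Rightarrow> ((complex ^ 'l) set \<Rightarrow> complex) set \<Rightarrow> bool" where
  "separable A P \<longleftrightarrow> wedge_space P (H1 A) \<inter> K_perp A \<subseteq> ext_square P"


subsection \<open>The subspace of a 2-flat lies in the resonance variety\<close>

lemma codim_triple:
  fixes X H L M :: "(complex ^ 'l) set"
  assumes "hyperplane H" "hyperplane L" "hyperplane M" "H \<noteq> L"
    and "codim X = 2" "X \<subseteq> H" "X \<subseteq> L" "X \<subseteq> M"
  shows "codim (H \<inter> L \<inter> M) = 2"
proof -
  have sub: "vec.subspace H" "vec.subspace L"
    and dims: "CARD('l) - vec.dim H = 1" "CARD('l) - vec.dim L = 1" "CARD('l) - vec.dim X = 2"
    using assms by (auto simp: hyperplane_def codim_def)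
  have eq: "vec.dim H = vec.dim L" using dims by linarith
  have "vec.dim (H \<inter> L) \<noteq> vec.dim H"
  proof
    assume *: "vec.dim (H \<inter> L) = vec.dim H"
    have "H \<inter> L = H"
      by (rule vec.subspace_dim_equal[OF vec.subspace_inter[OF sub] sub(1)]) (simp_all add: *)
    moreover have "H \<inter> L = L"
      by (rule vec.subspace_dim_equal[OF vec.subspace_inter[OF sub] sub(2)]) (simp_all add: * eq)
    ultimately show False using \<open>H \<noteq> L\<close> by blast
  qed
  moreover have "vec.dim (H \<inter> L) \<le> vec.dim H"
    by (rule vec.dim_subset) blast
  moreover have "vec.dim (H \<inter> L \<inter> M) \<le> vec.dim (H \<inter> L)"
    by (rule vec.dim_subset) blast
  moreover have "vec.dim X \<le> vec.dim (H \<inter> L \<inter> M)"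
    by (rule vec.dim_subset) (use assms in blast)
  ultimately show ?thesis unfolding codim_def using dims by linarith
qed

lemma local_component_subset_resonance:
  assumes "arrangement A" "X \<in> flats2 A" "card {H \<in> A. X \<subseteq> H} \<ge> 3"
  shows "local_component A X \<subseteq> resonance A"
proof
  fix a assume a: "a \<in> local_component A X"
  define S where "S = {H \<in> A. X \<subseteq> H}"
  have S: "finite S" "S \<subseteq> A" "card S \<ge> 3" "\<And>H. H \<in> S \<Longrightarrow> hyperplane H \<and> X \<subseteq> H" "codim X = 2"
    using assms by (auto simp: S_def arrangement_def flats2_def)
  have a0: "\<And>H. H \<notin> S \<Longrightarrow> a H = 0" "(\<Sum>H\<in>S. a H) = 0" "a \<in> H1 A"
    using a by (auto simp: local_component_def S_def H1_def)
  show "a \<in> resonance A"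
  proof (cases "a = 0")
    case False
    then obtain K where K: "a K \<noteq> 0" "K \<in> S" using a0(1) by (auto simp: fun_eq_iff)
    have "card (S - {K}) \<ge> 2" using S K by simp
    then have "S - {K} \<noteq> {}" by (intro notI) simp
    then obtain L where L: "L \<in> S" "L \<noteq> K" by blast
    have "card (S - {K, L}) \<ge> 1" using S K L by (simp add: card_Diff_subset)
    then have "S - {K, L} \<noteq> {}" by (intro notI) simp
    then obtain M where M: "M \<in> S" "M \<noteq> K" "M \<noteq> L" by blast
    define b :: "(complex ^ 'a) set \<Rightarrow> complex" where "b = basis_vec L - basis_vec M"
    have "wedge a b (K, L) = a K" using L M by (simp add: wedge_def b_def basis_vec_def)
    then have "wedge a b \<noteq> 0" using K by auto
    moreover have "b \<in> H1 A" using L M S by (auto simp: H1_def b_def basis_vec_def)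
    moreover have "wedge a b \<in> K_perp A"
    proof -
      have aeq: "a J = (\<Sum>H\<in>S. a H * (basis_vec H J - basis_vec M J))" for J
      proof -
        have "(\<Sum>H\<in>S. a H * basis_vec H J) = (\<Sum>H\<in>S. if J = H then a H else 0)"
          by (intro sum.cong refl) (simp add: basis_vec_def)
        also have "\<dots> = a J"
          using S(1) a0(1)[of J] by (simp only: sum.delta') simp
        finally have "(\<Sum>H\<in>S. a H * basis_vec H J) = a J" .
        then show ?thesis
          by (simp add: right_diff_distrib sum_subtractf a0(2) flip: sum_distrib_right)
      qed
      have "wedge a b = (\<Sum>H\<in>S. cscale (a H) (wedge (basis_vec H - basis_vec M) b))"
      proof (rule ext, clarify)
        fix I J
        have "wedge a b (I, J) = a I * b J - a J * b I" by (simp add: wedge_def)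
        also have "\<dots> = (\<Sum>H\<in>S. a H * (basis_vec H I - basis_vec M I) * b J
                         - a H * (basis_vec H J - basis_vec M J) * b I)"
          by (subst aeq[of I], subst aeq[of J]) (simp add: sum_subtractf sum_distrib_right)
        also have "\<dots> = (\<Sum>H\<in>S. cscale (a H) (wedge (basis_vec H - basis_vec M) b)) (I, J)"
          using S(1) by (induction S rule: finite_induct) (auto simp: cscale_def wedge_def algebra_simps)
        finally show "wedge a b (I, J) =
          (\<Sum>H\<in>S. cscale (a H) (wedge (basis_vec H - basis_vec M) b)) (I, J)" .
      qed
      moreover have "wedge (basis_vec H - basis_vec M) b \<in> K_perp A" if H: "H \<in> S" for H
      proof (cases "H = L \<or> H = M")
        case True
        then have "wedge (basis_vec H - basis_vec M) b = 0"
          by (auto simp: b_def wedge_def fun_eq_iff)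
        then show ?thesis by (simp add: K_perp_def cfun.span_zero)
      next
        case False
        then have "codim (H \<inter> L \<inter> M) = 2" using S H L M by (intro codim_triple[of H L M X]) auto
        then show ?thesis unfolding K_perp_def b_def
          using False H L M S(2) by (intro cfun.span_base) blast
      qed
      ultimately show ?thesis unfolding K_perp_def
        by (auto intro!: cfun.span_sum cfun.span_scale)
    qed
    ultimately show ?thesis using a0(3) by (auto simp: resonance_def)
  qed (simp add: resonance_def)
qed

end

theory Submission
  imports Defs
begin

text \<open>
  The flat \<open>H \<inter> K\<close> of two distinct hyperplanes determines the generators of \<open>K\<^sup>\<bottom>\<close> with a nonzero
  entry at \<open>(H, K)\<close>. Hence every \<open>w \<in> K\<^sup>\<bottom>\<close> has vanishing row sums over each 2-flat separately.
  An element of \<open>P\<^sub>X \<and> V\<^sup>\<or>\<close> has no entry outside the rows and columns of hyperplanes through \<open>X\<close>.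
  If \<open>H\<close> contains \<open>X\<close> and \<open>K\<close> does not, then \<open>H\<close> is the only hyperplane through \<open>X\<close> that contains
  \<open>H \<inter> K\<close>, so the sum of row \<open>K\<close> over the flat \<open>H \<inter> K\<close> is the single entry at \<open>(K, H)\<close>, which
  therefore vanishes. What remains is an antisymmetric array on the hyperplanes through \<open>X\<close> with zero
  row sums, that is, an element of \<open>\<And>\<^sup>2 P\<^sub>X\<close>.
\<close>

text \<open>If \<open>H + K\<close> had the dimension of \<open>H\<close>, both hyperplanes would
  equal it. So the sum is the whole space, and the dimension formula for sums and intersections
  gives the codimension.\<close>

lemma codim_Int_hyperplanes:
  fixes H K :: "(complex ^ 'l) set"
  assumes "hyperplane H" "hyperplane K" "H \<noteq> K"
  shows "codim (H \<inter> K) = 2"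
proof -
  have sub: "vec.subspace H" "vec.subspace K"
    and dims: "CARD('l) - vec.dim H = 1" "CARD('l) - vec.dim K = 1"
    using assms by (auto simp: hyperplane_def codim_def)
  define U where "U = {x + y |x y. x \<in> H \<and> y \<in> K}"
  have U: "vec.dim U + vec.dim (H \<inter> K) = vec.dim H + vec.dim K"
    unfolding U_def by (rule vec.dim_sums_Int[OF sub])
  have sU: "vec.subspace U"
    unfolding U_def by (rule vec.subspace_sums[OF sub])
  have "H \<subseteq> U" "K \<subseteq> U"
    unfolding U_def using vec.subspace_0[OF sub(1)] vec.subspace_0[OF sub(2)]
    by (force intro: exI[of _ 0])+
  have "vec.dim U \<noteq> vec.dim H"
  proof
    assume *: "vec.dim U = vec.dim H"
    have "H = U"
      by (rule vec.subspace_dim_equal[OF sub(1) sU \<open>H \<subseteq> U\<close>]) (simp add: *)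
    moreover have "K = U"
      by (rule vec.subspace_dim_equal[OF sub(2) sU \<open>K \<subseteq> U\<close>]) (use * dims in linarith)
    ultimately show False using \<open>H \<noteq> K\<close> by simp
  qed
  moreover have "vec.dim H \<le> vec.dim U" using \<open>H \<subseteq> U\<close> by (rule vec.dim_subset)
  moreover have "vec.dim U \<le> CARD('l)" by (rule dim_subset_UNIV_cart_gen)
  ultimately show ?thesis using U dims unfolding codim_def by linarith
qed

lemma codim_2_eq_Int:
  fixes H K Y :: "(complex ^ 'l) set"
  assumes "hyperplane H" "hyperplane K" "H \<noteq> K"
    and "vec.subspace Y" "codim Y = 2" "Y \<subseteq> H" "Y \<subseteq> K"
  shows "Y = H \<inter> K"
proof (rule vec.subspace_dim_equal)
  show "vec.dim (H \<inter> K) \<le> vec.dim Y"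
    using codim_Int_hyperplanes[OF assms(1-3)] assms(5) unfolding codim_def by linarith
qed (use assms in \<open>auto simp: hyperplane_def intro: vec.subspace_inter\<close>)

text \<open>Both sides have codimension 2 and one lies in the other. So a flat
  \<open>H \<inter> K\<close> is already cut out by \<open>K\<close> and any other hyperplane
  through it.\<close>

lemma Int_hyperplanes_eq:
  fixes H K L :: "(complex ^ 'l) set"
  assumes "hyperplane H" "hyperplane K" "hyperplane L" "H \<noteq> K" "L \<noteq> K" "H \<inter> K \<subseteq> L"
  shows "H \<inter> K = L \<inter> K"
  by (rule codim_2_eq_Int)
    (use assms codim_Int_hyperplanes in \<open>auto simp: hyperplane_def intro: vec.subspace_inter\<close>)

text \<open>The sum is linear in \<open>w\<close>, so generators suffice. Row \<open>K\<close> of a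
  generator is zero unless \<open>K\<close> belongs to its triple. If it does, either the whole
  triple passes through \<open>H \<inter> K\<close> and the coordinates of each factor cancel, or
  only the diagonal entry at \<open>(K, K)\<close> is summed.\<close>

lemma K_perp_row_sum:
  fixes A :: "(complex ^ 'l) set set"
  assumes A: "arrangement A" and HK: "H \<in> A" "K \<in> A" "H \<noteq> K" and w: "w \<in> K_perp A"
  shows "(\<Sum>J | J \<in> A \<and> H \<inter> K \<subseteq> J. w (K, J)) = 0"
proof -
  define T where "T = {J \<in> A. H \<inter> K \<subseteq> J}"
  have T: "finite T" "K \<in> T"
    using A HK by (auto simp: T_def arrangement_def)
  have hyp: "hyperplane J" if "J \<in> A" for J using A that by (simp add: arrangement_def)
  have sum_basis: "(\<Sum>J\<in>T. basis_vec I J) = (if I \<in> T then 1 else 0)" for I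
    using T by (simp add: basis_vec_def)
  from w have "(\<Sum>J\<in>T. w (K, J)) = 0"
    unfolding K_perp_def
  proof (induction rule: cfun.span_induct_alt)
    case base
    show ?case by simp
  next
    case (step c g w)
    from step(1) obtain L M N where g: "g = wedge (basis_vec L - basis_vec N) (basis_vec M - basis_vec N)"
      and LMN: "L \<in> A" "M \<in> A" "N \<in> A" "L \<noteq> M" "L \<noteq> N" "M \<noteq> N" "codim (L \<inter> M \<inter> N) = 2"
      by blast
    have sub: "vec.subspace (L \<inter> M \<inter> N)"
      using hyp LMN by (auto simp: hyperplane_def intro: vec.subspace_inter)
    have eqs: "L \<inter> M \<inter> N = L \<inter> M" "L \<inter> M \<inter> N = L \<inter> N" "L \<inter> M \<inter> N = M \<inter> N"
      by (rule codim_2_eq_Int; use sub LMN hyp in auto)+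
    \<comment> \<open>Two members of the triple through \<open>H \<inter> K\<close>, one of them
      \<open>K\<close>, have intersection \<open>H \<inter> K\<close>; by \<open>eqs\<close> this is
      the flat of the triple, so the third member contains it too.\<close>
    have all: "I \<in> T \<Longrightarrow> I \<in> {L, M, N} \<Longrightarrow> I \<noteq> K \<Longrightarrow> K \<in> {L, M, N} \<Longrightarrow> {L, M, N} \<subseteq> T" for I
    proof -
      assume I: "I \<in> T" "I \<in> {L, M, N}" "I \<noteq> K" "K \<in> {L, M, N}"
      then have "H \<inter> K = I \<inter> K"
        using HK hyp by (intro Int_hyperplanes_eq) (auto simp: T_def)
      moreover have "I \<inter> K = L \<inter> M \<inter> N" using I eqs by auto
      ultimately show ?thesis using LMN by (auto simp: T_def)
    qed
    define c d :: complex where "c = basis_vec L K - basis_vec N K" and "d = basis_vec M K - basis_vec N K"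
    have "(\<Sum>J\<in>T. g (K, J)) =
        (\<Sum>J\<in>T. c * (basis_vec M J - basis_vec N J) - d * (basis_vec L J - basis_vec N J))"
      by (simp add: g wedge_def c_def d_def mult.commute)
    also have "\<dots> = c * ((\<Sum>J\<in>T. basis_vec M J) - (\<Sum>J\<in>T. basis_vec N J))
        - d * ((\<Sum>J\<in>T. basis_vec L J) - (\<Sum>J\<in>T. basis_vec N J))"
      by (simp only: sum_subtractf flip: sum_distrib_left)
    also have "\<dots> = 0"
    proof (cases "K \<in> {L, M, N}")
      case True
      then have "{L, M, N} \<subseteq> T \<or> T \<inter> {L, M, N} = {K}" using all T(2) by blast
      then show ?thesis
      proof
        assume "{L, M, N} \<subseteq> T"
        then show ?thesis by (simp add: sum_basis)
      next
        assume "T \<inter> {L, M, N} = {K}"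
        have "(\<Sum>J\<in>T. basis_vec I J) = (basis_vec I K :: complex)" if "I \<in> {L, M, N}" for I
        proof -
          have "I \<in> T \<longleftrightarrow> K = I" using \<open>T \<inter> {L, M, N} = {K}\<close> that by blast
          then show ?thesis unfolding sum_basis unfolding basis_vec_def by simp
        qed
        \<comment> \<open>Only \<open>J = K\<close> contributes, so the expression collapses to
          \<open>c * d - d * c\<close>.\<close>
        then show ?thesis by (simp add: c_def d_def mult.commute)
      qed
    next
      case False
      then have "c = 0" "d = 0" by (auto simp: c_def d_def basis_vec_def)
      then show ?thesis by simp
    qed
    finally have "(\<Sum>J\<in>T. g (K, J)) = 0" .
    then show ?case
      using step by (simp add: cscale_def sum.distrib flip: sum_distrib_left)
  qed
  then show ?thesis by (simp add: T_def)
qed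

lemma wedge_space_antisym:
  assumes "w \<in> wedge_space P Q"
  shows "w (J, I) = - w (I, J)"
  using assms unfolding wedge_space_def
  by (induction rule: cfun.span_induct_alt) (auto simp: cscale_def wedge_def algebra_simps)

lemma wedge_space_entry_eq_0:
  assumes "w \<in> wedge_space P Q"
    and "\<And>a b. a \<in> P \<Longrightarrow> b \<in> Q \<Longrightarrow> a I * b J = a J * b I"
  shows "w (I, J) = 0"
  using assms(1) unfolding wedge_space_def
  by (induction rule: cfun.span_induct_alt) (auto simp: cscale_def wedge_def assms(2))

text \<open>Vanishing row sums, and by antisymmetry column sums, allow each basis vector to be
  replaced by its difference with \<open>basis_vec M\<close> in both indices. This writes
  \<open>w\<close> as a combination of wedges of these differences.\<close>

lemma antisym_array_in_ext_square:
  fixes w :: "'h \<times> 'h \<Rightarrow> complex"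
  assumes S: "finite S" "M \<in> S"
    and P: "\<And>H. H \<in> S \<Longrightarrow> basis_vec H - basis_vec M \<in> P"
    and anti: "\<And>I J. w (J, I) = - w (I, J)"
    and supp: "\<And>I J. I \<notin> S \<Longrightarrow> w (I, J) = 0"
    and rows: "\<And>I. I \<in> S \<Longrightarrow> (\<Sum>J\<in>S. w (I, J)) = 0"
  shows "w \<in> ext_square P"
proof -
  define u where "u H = (basis_vec H - basis_vec M :: 'h \<Rightarrow> complex)" for H
  have supp': "w (I, J) = 0" if "J \<notin> S" for I J
    using anti[of I J] supp[OF that, of I] by simp
  have row: "(\<Sum>K\<in>S. w (H, K) * u K J) = w (H, J)" if "H \<in> S" for H J
  proof -
    have "(\<Sum>K\<in>S. w (H, K) * basis_vec K J) = (\<Sum>K\<in>S. if J = K then w (H, K) else 0)"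
      by (intro sum.cong refl) (simp add: basis_vec_def)
    also have "\<dots> = w (H, J)" using S(1) supp'[of J H] by (simp only: sum.delta') simp
    finally show ?thesis
      by (simp add: u_def right_diff_distrib sum_subtractf rows[OF that] flip: sum_distrib_right)
  qed
  have col: "(\<Sum>H\<in>S. w (H, J) * u H I) = w (I, J)" for I J
  proof (cases "J \<in> S")
    case True
    have "(\<Sum>H\<in>S. w (H, J) * u H I) = - (\<Sum>H\<in>S. w (J, H) * u H I)"
      by (simp add: anti[of _ J] flip: sum_negf)
    also have "\<dots> = w (I, J)" using row[OF True] anti[of J I] by simp
    finally show ?thesis .
  qed (simp add: supp')
  have dbl: "(\<Sum>H\<in>S. \<Sum>K\<in>S. w (H, K) * (u H I * u K J)) = w (I, J)" for I J
  proof -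
    have "(\<Sum>H\<in>S. \<Sum>K\<in>S. w (H, K) * (u H I * u K J)) = (\<Sum>H\<in>S. (\<Sum>K\<in>S. w (H, K) * u K J) * u H I)"
      unfolding sum_distrib_right by (intro sum.cong refl) (simp add: mult_ac)
    also have "\<dots> = (\<Sum>H\<in>S. w (H, J) * u H I)" by (intro sum.cong refl) (simp only: row)
    finally show ?thesis by (simp only: col)
  qed
  \<comment> \<open>The double sum meets every unordered pair twice, hence the factor 1/2.\<close>
  have "w = (\<Sum>H\<in>S. \<Sum>K\<in>S. cscale (w (H, K) / 2) (wedge (u H) (u K)))"
  proof (rule ext, clarify)
    fix I J
    have app: "(\<Sum>x\<in>T. f x) p = (\<Sum>x\<in>T. f x p)" for T :: "'h set" and f :: "'h \<Rightarrow> 'h \<times> 'h \<Rightarrow> complex" and p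
      by (induction T rule: infinite_finite_induct) auto
    have "(\<Sum>H\<in>S. \<Sum>K\<in>S. cscale (w (H, K) / 2) (wedge (u H) (u K))) (I, J) =
      ((\<Sum>H\<in>S. \<Sum>K\<in>S. w (H, K) * (u H I * u K J)) - (\<Sum>H\<in>S. \<Sum>K\<in>S. w (H, K) * (u H J * u K I))) / 2"
      by (simp add: app cscale_def wedge_def sum_divide_distrib diff_divide_distrib
          right_diff_distrib sum_subtractf)
    also have "\<dots> = w (I, J)" using anti[of J I] by (simp add: dbl)
    finally show "w (I, J) = (\<Sum>H\<in>S. \<Sum>K\<in>S. cscale (w (H, K) / 2) (wedge (u H) (u K))) (I, J)" ..
  qed
  also have "\<dots> \<in> ext_square P"
    unfolding ext_square_def wedge_space_def
    using P by (intro cfun.span_sum cfun.span_scale cfun.span_base) (auto simp: u_def)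
  finally show ?thesis .
qed

theorem proposition9p8:
  fixes A :: "(complex ^ 'l) set set" and X :: "(complex ^ 'l) set"
  assumes "arrangement A"
    and "X \<in> flats2 A"
    and "card {H \<in> A. X \<subseteq> H} \<ge> 3"
  shows "separable A (local_component A X)"
  unfolding separable_def
proof
  fix w assume w: "w \<in> wedge_space (local_component A X) (H1 A) \<inter> K_perp A"
  define S where "S = {H \<in> A. X \<subseteq> H}"
  have finA: "finite A" and hyp: "\<And>H. H \<in> A \<Longrightarrow> hyperplane H"
    using assms(1) by (auto simp: arrangement_def)
  have S: "finite S" "S \<subseteq> A" using finA by (auto simp: S_def)
  have X: "vec.subspace X" "codim X = 2"
    using assms(2) hyp by (auto simp: flats2_def hyperplane_def intro!: vec.subspace_Inter)
  have X_eq: "X = H \<inter> K" if "H \<in> S" "K \<in> S" "H \<noteq> K" for H K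
    by (rule codim_2_eq_Int) (use that X hyp in \<open>auto simp: S_def\<close>)
  \<comment> \<open>A second hyperplane through \<open>X\<close> exhibits \<open>X\<close> as an
    intersection with a given one, as the row sum lemma requires.\<close>
  have other: "\<exists>K\<in>S. K \<noteq> H" for H
  proof (rule ccontr)
    assume "\<not> ?thesis"
    then have "card S \<le> card {H}" by (intro card_mono) auto
    then show False using assms(3) by (simp add: S_def)
  qed
  have anti: "w (J, I) = - w (I, J)" for I J
    using w by (intro wedge_space_antisym) auto
  have P0: "a I = 0" if "a \<in> local_component A X" "I \<notin> S" for a I
    using that by (cases "I \<in> A") (auto simp: local_component_def H1_def S_def)
  have outside: "w (I, J) = 0" if "I \<notin> S" "J \<notin> S" for I J
  proof (rule wedge_space_entry_eq_0)
    fix a b assume "a \<in> local_component A X"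
    then have "a I = 0" "a J = 0" using P0 that by blast+
    then show "a I * b J = a J * b I" by simp
  qed (use w in blast)
  have "w (K, H) = 0" if "K \<in> A - S" "H \<in> S" for K H
  proof -
    have KH: "K \<in> A" "H \<in> A" "H \<noteq> K" "\<not> X \<subseteq> K" using that by (auto simp: S_def)
    \<comment> \<open>If such a \<open>J\<close> contained \<open>X\<close>, then
      \<open>K \<inter> H = J \<inter> H = X\<close> would put \<open>X\<close> inside
      \<open>K\<close>. The case \<open>J = K\<close> is included.\<close>
    have "w (K, J) = 0" if J: "J \<in> A" "H \<inter> K \<subseteq> J" "J \<noteq> H" for J
    proof (rule outside)
      show "J \<notin> S"
      proof
        assume "J \<in> S"
        have "K \<inter> H = J \<inter> H"
          using J KH hyp by (intro Int_hyperplanes_eq) auto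
        moreover have "X = J \<inter> H" using X_eq \<open>J \<in> S\<close> \<open>H \<in> S\<close> J by blast
        ultimately show False using KH by blast
      qed
    qed (use that \<open>K \<in> A - S\<close> in auto)
    then have "(\<Sum>J | J \<in> A \<and> H \<inter> K \<subseteq> J. w (K, J)) = (\<Sum>J\<in>{H}. w (K, J))"
      using finA KH by (intro sum.mono_neutral_right) auto
    then show ?thesis
      using K_perp_row_sum[OF assms(1) KH(2,1,3)] w by simp
  qed
  \<comment> \<open>Arrays are indexed by all sets of vectors, so indices outside the arrangement
    are treated separately.\<close>
  moreover have "w (K, H) = 0" if "K \<notin> A" for K H
  proof (rule wedge_space_entry_eq_0)
    fix a b assume "a \<in> local_component A X" "b \<in> H1 A"
    then have "a K = 0" "b K = 0" using that by (auto simp: local_component_def H1_def)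
    then show "a K * b H = a H * b K" by simp
  qed (use w in blast)
  ultimately have supp: "w (I, J) = 0" if "I \<notin> S" for I J
    using outside that by blast
  have rows: "(\<Sum>J\<in>S. w (I, J)) = 0" if I: "I \<in> S" for I
  proof -
    obtain K where K: "K \<in> S" "K \<noteq> I" using other by blast
    then have "K \<inter> I = X" using X_eq I by blast
    then show ?thesis
      \<comment> \<open>The hyperplanes through \<open>K \<inter> I = X\<close> are exactly those in
        \<open>S\<close>, so the flat sum is the full row sum.\<close>
      using K_perp_row_sum[OF assms(1), of K I w] K I S w by (auto simp: S_def)
  qed
  obtain M where M: "M \<in> S" using other by blast
  show "w \<in> ext_square (local_component A X)"
  proof (rule antisym_array_in_ext_square[OF S(1) M _ anti supp rows])
    fix H assume H: "H \<in> S"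
    have "(\<Sum>J\<in>S. (basis_vec H - basis_vec M) J :: complex) = 0"
      using S(1) H M by (simp add: basis_vec_def sum_subtractf)
    then show "basis_vec H - basis_vec M \<in> local_component A X"
      using H M by (auto simp: local_component_def H1_def basis_vec_def S_def)
  qed
qed

end
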